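(* Let $m,n\ge1$ and $t>r\ge 1$ be integers with $m\le 2(t-r)+1$, and let $K_{m,n}$ be the king's grid graph with $m$ rows and $n$ columns. Then \[\gamma_{t,r}(K_{m,n})=\left\lceil \frac{n+r-1}{2t-r}\right\rceil .\]
   Context: The king's grid graph $K_{m,n}$ has as vertices the integer points of an array with $m$ rows and $n$ columns, each vertex being adjacent to its horizontal, vertical and diagonal neighbors (legal king moves on a chessboard). For a connected graph $G$ with vertex set $V(G)$ and graph distance $d$, positive integers $t,r$, and a set $\mathbb T\subseteq V(G)$ (whose elements are called towers, of strength $t$), the signal received by $v\in V(G)$ is $f(v)=\sum_{w\in\mathbb T}\max\{0,\,t-d(v,w)\}$ (a tower also receives its own signal). The set $\mathbb T$ is a $(t,r)$ broadcast dominating set if $f(v)\ge r$ for every $v\in V(G)$. The $(t,r)$ broadcast domination number $\gamma_{t,r}(G)$ is the minimum cardinality of a $(t,r)$ broadcast dominating set of $G$. *)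

theory Defs
  imports Complex_Main "Graph_Theory.Graph_Theory"
begin

text \<open>
  Undirected graphs are represented as in \<open>Graph_Theory\<close>, namely as digraphs with a symmetric
  arc relation. The general definitions below are meant for finite connected graphs (locale
  \<open>graph\<close>, predicate \<open>connected\<close>); \<open>LEAST\<close> is unspecified when no candidate
  exists, which does not happen for \<open>graph_dist\<close> on a connected graph, nor for the domination number
  when \<open>r \<le> t\<close> (lemma \<open>broadcast_dominating_verts\<close>).
\<close>

definition graph_dist :: "('a, 'b) pre_digraph \<Rightarrow> 'a \<Rightarrow> 'a \<Rightarrow> nat" where
  "graph_dist G u v = (LEAST k. \<exists>p. pre_digraph.awalk G u p v \<and> length p = k)"

definition broadcast_signal :: "('a, 'b) pre_digraph \<Rightarrow> nat \<Rightarrow> 'a set \<Rightarrow> 'a \<Rightarrow> int" where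
  "broadcast_signal G t T v = (\<Sum>w\<in>T. max 0 (int t - int (graph_dist G v w)))"

definition broadcast_dominating :: "('a, 'b) pre_digraph \<Rightarrow> nat \<Rightarrow> nat \<Rightarrow> 'a set \<Rightarrow> bool" where
  "broadcast_dominating G t r T \<longleftrightarrow>
     T \<subseteq> verts G \<and> (\<forall>v\<in>verts G. broadcast_signal G t T v \<ge> int r)"

definition broadcast_domination_number :: "('a, 'b) pre_digraph \<Rightarrow> nat \<Rightarrow> nat \<Rightarrow> nat" where
  "broadcast_domination_number G t r = (LEAST k. \<exists>T. broadcast_dominating G t r T \<and> card T = k)"

definition king_grid :: "nat \<Rightarrow> nat \<Rightarrow> (int \<times> int, (int \<times> int) \<times> (int \<times> int)) pre_digraph" where
  "king_grid m n = with_proj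
     \<lparr> pverts = {1..int m} \<times> {1..int n},
       parcs = {(u, v). u \<in> {1..int m} \<times> {1..int n} \<and> v \<in> {1..int m} \<times> {1..int n} \<and> u \<noteq> v \<and>
                  \<bar>fst u - fst v\<bar> \<le> 1 \<and> \<bar>snd u - snd v\<bar> \<le> 1} \<rparr>"

lemma verts_king_grid: "verts (king_grid m n) = {1..int m} \<times> {1..int n}"
  by (simp add: king_grid_def)

lemma graph_king_grid: "graph (king_grid m n)"
proof -
  let ?V = "{1..int m} \<times> {1..int n}"
  let ?G = "\<lparr> pverts = ?V,
       parcs = {(u, v). u \<in> ?V \<and> v \<in> ?V \<and> u \<noteq> v \<and>
                  \<bar>fst u - fst v\<bar> \<le> 1 \<and> \<bar>snd u - snd v\<bar> \<le> 1} \<rparr>"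
  have fin: "finite (parcs ?G)"
    by (rule finite_subset[of _ "?V \<times> ?V"]) auto
  have "pair_graph ?G"
    by unfold_locales (use fin in \<open>auto simp: symmetric_def intro!: symI\<close>)
  then show ?thesis
    unfolding king_grid_def by (rule pair_graph.pair_graphD_graph)
qed

lemma connected_king_grid:
  assumes "m \<ge> 1" "n \<ge> 1"
  shows "connected (king_grid m n)"
proof -
  interpret graph "king_grid m n" by (rule graph_king_grid)
  let ?G = "king_grid m n"
  have arc: "(i, j) \<rightarrow>\<^bsub>?G\<^esub> (i', j')"
    if "(i, j) \<in> verts ?G" "(i', j') \<in> verts ?G" "(i, j) \<noteq> (i', j')"
       "\<bar>i - i'\<bar> \<le> 1" "\<bar>j - j'\<bar> \<le> 1" for i j i' j'
    using that by (auto simp: king_grid_def arcs_ends_def arc_to_ends_def)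
  have to_origin: "(i, j) \<rightarrow>\<^sup>*\<^bsub>?G\<^esub> (1, 1)" if "(i, j) \<in> verts ?G" for i j
    using that
  proof (induction "nat (i + j)" arbitrary: i j rule: less_induct)
    case less
    show ?case
    proof (cases "i = 1 \<and> j = 1")
      case True
      then show ?thesis using less.prems by auto
    next
      case False
      define i' where "i' = max 1 (i - 1)"
      define j' where "j' = max 1 (j - 1)"
      have v: "(i', j') \<in> verts ?G"
        using less.prems by (auto simp: verts_king_grid i'_def j'_def)
      have "(i, j) \<rightarrow>\<^bsub>?G\<^esub> (i', j')"
        by (rule arc) (use less.prems v False in \<open>auto simp: verts_king_grid i'_def j'_def\<close>)
      moreover have "(i', j') \<rightarrow>\<^sup>*\<^bsub>?G\<^esub> (1, 1)"
        by (rule less.hyps) (use less.prems v False in \<open>auto simp: verts_king_grid i'_def j'_def\<close>)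
      ultimately show ?thesis by (rule adj_reachable_trans)
    qed
  qed
  have "strongly_connected ?G"
  proof (rule strongly_connectedI)
    show "verts ?G \<noteq> {}" using assms by (auto simp: verts_king_grid)
  next
    fix u v assume "u \<in> verts ?G" "v \<in> verts ?G"
    then have "u \<rightarrow>\<^sup>*\<^bsub>?G\<^esub> (1, 1)" "v \<rightarrow>\<^sup>*\<^bsub>?G\<^esub> (1, 1)"
      using to_origin by (cases u; cases v; blast)+
    then show "u \<rightarrow>\<^sup>*\<^bsub>?G\<^esub> v"
      using symmetric_reachable[OF sym_arcs] reachable_trans by blast
  qed
  then show ?thesis
    unfolding connected_def strongly_connected_def
    by (auto intro: reachable_mk_symmetricI)
qed

lemma broadcast_dominating_verts:
  assumes "graph G" "r \<le> t"
  shows "broadcast_dominating G t r (verts G)"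
proof -
  interpret graph G by fact
  have "broadcast_signal G t (verts G) v \<ge> int r" if v: "v \<in> verts G" for v
  proof -
    have "graph_dist G v v = 0"
      unfolding graph_dist_def
      by (rule Least_eq_0) (use v in \<open>auto simp: awalk_Nil_iff\<close>)
    then have "int r \<le> max 0 (int t - int (graph_dist G v v))" using assms(2) by simp
    also have "\<dots> \<le> broadcast_signal G t (verts G) v"
      unfolding broadcast_signal_def
      by (rule member_le_sum[OF v, of "\<lambda>w. max 0 (int t - int (graph_dist G v w))"]) auto
    finally show ?thesis .
  qed
  then show ?thesis by (simp add: broadcast_dominating_def)
qed

end

theory Submission
  imports Defs
begin

text \<open>
  King's distance is the Chebyshev distance, so projecting a dominating set to the columns can only
  strengthen the signal. The lower bound is therefore a statement about towers on a path: a tower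
  at a column at most \<open>t - r + 1\<close> influences only the first \<open>2 * t - r\<close> columns; if there is none,
  column 1 must be served by two towers at columns at most \<open>t\<close>, which influence only the first
  \<open>2 * t - 1\<close> columns. Cutting off these columns and towers gives an induction. The bound is attained
  by towers on the middle row at distance \<open>2 * t - r\<close>: close to a tower (at most \<open>t - r\<close> columns away) that tower
  suffices whatever the row, and elsewhere the row offset does not matter to the distance.
\<close>

section \<open>Graph distance in the king's grid\<close>

lemma king_grid_ends [simp]: "tail (king_grid m n) = fst" "head (king_grid m n) = snd"
  by (simp_all add: king_grid_def)

lemma arcs_king_grid:
  "(u, v) \<in> arcs (king_grid m n) \<longleftrightarrow> u \<in> verts (king_grid m n) \<and> v \<in> verts (king_grid m n) \<and>
     u \<noteq> v \<and> \<bar>fst u - fst v\<bar> \<le> 1 \<and> \<bar>snd u - snd v\<bar> \<le> 1"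
  by (auto simp: king_grid_def)

lemma awalk_king_grid_dist:
  assumes "pre_digraph.awalk (king_grid m n) u p v"
  shows "max \<bar>fst u - fst v\<bar> \<bar>snd u - snd v\<bar> \<le> int (length p)"
proof -
  interpret graph "king_grid m n" by (rule graph_king_grid)
  show ?thesis
    using assms
  proof (induction p arbitrary: u)
    case Nil
    then show ?case by (simp add: awalk_Nil_iff)
  next
    case (Cons e p)
    then have "(u, snd e) \<in> arcs (king_grid m n)" "awalk (snd e) p v"
      by (auto simp: awalk_Cons_iff)
    then show ?case
      using Cons.IH[of "snd e"] by (auto simp: arcs_king_grid)
  qed
qed

lemma awalk_king_grid_exists:
  assumes "u \<in> verts (king_grid m n)" "v \<in> verts (king_grid m n)"
    and "max \<bar>fst u - fst v\<bar> \<bar>snd u - snd v\<bar> = int k"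
  shows "\<exists>p. pre_digraph.awalk (king_grid m n) u p v \<and> length p = k"
proof -
  interpret graph "king_grid m n" by (rule graph_king_grid)
  show ?thesis
    using assms
  proof (induction k arbitrary: u)
    case 0
    then have "u = v" by (auto simp: prod_eq_iff max_def split: if_splits)
    with 0 show ?case by (auto simp: awalk_Nil_iff intro!: exI[of _ "[]"])
  next
    case (Suc k)
    \<comment> \<open>\<open>w\<close> is one king move towards \<open>v\<close>: every nonzero
      coordinate offset shrinks by one and none changes sign, so \<open>w\<close> stays between
      \<open>u\<close> and \<open>v\<close>, hence inside the grid.\<close>
    define w where "w = (fst u + sgn (fst v - fst u), snd u + sgn (snd v - snd u))"
    have w: "w \<in> verts (king_grid m n)"
      using Suc.prems by (auto simp: verts_king_grid w_def sgn_if mem_Times_iff)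
    have "max \<bar>fst w - fst v\<bar> \<bar>snd w - snd v\<bar> = int k"
    proof -
      have "\<bar>a + sgn (b - a) - b\<bar> = max 0 (\<bar>a - b\<bar> - 1)" for a b :: int
        by (auto simp: sgn_if)
      with Suc.prems(3) show ?thesis by (simp add: w_def)
    qed
    then obtain p where p: "awalk w p v" "length p = k"
      using Suc.IH w Suc.prems(2) by blast
    have "u \<noteq> w"
      using Suc.prems(3) by (auto simp: w_def sgn_if prod_eq_iff split: if_splits)
    then have "(u, w) \<in> arcs (king_grid m n)"
      using Suc.prems(1) w
      by (auto simp: arcs_king_grid w_def sgn_if)
    then have "awalk u ((u, w) # p) v"
      using p by (simp add: awalk_Cons_iff)
    with p show ?case by (intro exI[of _ "(u, w) # p"]) simp
  qed
qed

lemma graph_dist_king_grid: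
  assumes "u \<in> verts (king_grid m n)" "v \<in> verts (king_grid m n)"
  shows "int (graph_dist (king_grid m n) u v) = max \<bar>fst u - fst v\<bar> \<bar>snd u - snd v\<bar>"
proof -
  define k where "k = nat (max \<bar>fst u - fst v\<bar> \<bar>snd u - snd v\<bar>)"
  have k: "max \<bar>fst u - fst v\<bar> \<bar>snd u - snd v\<bar> = int k" by (simp add: k_def le_max_iff_disj)
  have "graph_dist (king_grid m n) u v = k"
    unfolding graph_dist_def
  proof (rule Least_equality)
    show "\<exists>p. pre_digraph.awalk (king_grid m n) u p v \<and> length p = k"
      using awalk_king_grid_exists[OF assms k] .
  next
    fix l assume "\<exists>p. pre_digraph.awalk (king_grid m n) u p v \<and> length p = l"
    then show "k \<le> l" using awalk_king_grid_dist k by fastforce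
  qed
  with k show ?thesis by metis
qed

section \<open>Lower bound for towers on a path\<close>

text \<open>Towers are indexed by \<open>T\<close> and placed by \<open>c\<close>, so that several
  may share a column. Their columns are not confined to \<open>{1..n}\<close>, because cutting off
  \<open>s\<close> columns shifts the remaining towers by \<open>s\<close>, possibly to the left of
  column 1.\<close>

lemma path_broadcast_lower_bound:
  fixes c :: "'a \<Rightarrow> int" and t r n :: int
  assumes "finite T" "1 \<le> r" "r < t" "1 \<le> n"
    and "\<And>x. 1 \<le> x \<Longrightarrow> x \<le> n \<Longrightarrow> r \<le> (\<Sum>w\<in>T. max 0 (t - \<bar>x - c w\<bar>))"
  shows "n + r - 1 \<le> int (card T) * (2 * t - r)"
  using assms(1,4,5)
proof (induction "card T" arbitrary: T c n rule: less_induct)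
  case less
  note fin = less.prems(1) and dom = less.prems(3)
  \<comment> \<open>The towers in \<open>S\<close> do not reach beyond column \<open>s\<close>, so the rest dominates the columns after \<open>s\<close>.\<close>
  have cut: ?case
    if S: "S \<subseteq> T" "S \<noteq> {}" and s: "0 \<le> s" "s < n" "s \<le> int (card S) * (2 * t - r)"
      and reach: "\<And>w. w \<in> S \<Longrightarrow> c w + t \<le> s + 1" for S s
  proof -
    have finS: "finite S" using S fin finite_subset by blast
    have card: "card T = card (T - S) + card S"
      using card_Diff_subset[OF finS S(1)] card_mono[OF fin S(1)] by simp
    have "card S > 0" using S finS by (simp add: card_gt_0_iff)
    moreover have "r \<le> (\<Sum>w\<in>T - S. max 0 (t - \<bar>x - (c w - s)\<bar>))" if "1 \<le> x" "x \<le> n - s" for x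
    proof -
      have "r \<le> (\<Sum>w\<in>T. max 0 (t - \<bar>x + s - c w\<bar>))"
        using dom[of "x + s"] that s by simp
      also have "\<dots> = (\<Sum>w\<in>T - S. max 0 (t - \<bar>x + s - c w\<bar>)) + (\<Sum>w\<in>S. max 0 (t - \<bar>x + s - c w\<bar>))"
        by (rule sum.subset_diff[OF S(1) fin])
      also have "(\<Sum>w\<in>S. max 0 (t - \<bar>x + s - c w\<bar>)) = 0"
        by (rule sum.neutral) (use reach that in fastforce)
      finally show ?thesis by (simp add: algebra_simps)
    qed
    ultimately have "n - s + r - 1 \<le> int (card (T - S)) * (2 * t - r)"
      using less.hyps[of "T - S" "n - s" "\<lambda>w. c w - s"] card fin s by simp
    with s(3) show ?thesis by (simp add: card algebra_simps)
  qed
  have mult: "int k * (2 * t - r) \<le> int (card T) * (2 * t - r)" if "k \<le> card T" for k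
    using that assms(2,3) by (intro mult_right_mono) auto
  consider w where "w \<in> T" "c w \<le> t - r + 1" | "\<And>w. w \<in> T \<Longrightarrow> c w > t - r + 1"
    by force
  then show ?case
  proof cases
    case 1
    show ?thesis
    proof (cases "2 * t - r < n")
      case True
      then show ?thesis using cut[of "{w}" "2 * t - r"] 1 assms(2,3) by simp
    next
      case False
      show ?thesis
      proof (cases "2 \<le> card T")
        case True
        then show ?thesis using False mult[of 2] assms(2,3) by simp
      next
        case False
        with 1 fin have "T = {w}"
          by (metis One_nat_def Suc_leI card_1_singleton_iff card_gt_0_iff empty_iff le_antisym
              not_less_eq_eq numeral_2_eq_2 singletonD)
        \<comment> \<open>Column \<open>n\<close> gets its signal from \<open>w\<close> alone, so
          \<open>n \<le> c w + t - r \<le> 2 * t - 2 * r + 1\<close>.\<close>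
        with dom[of n] less.prems(2) 1 assms(2,3) show ?thesis by simp
      qed
    qed
  next
    case 2
    have "\<exists>w1\<in>T. c w1 \<le> t"
    proof (rule ccontr)
      assume "\<not> ?thesis"
      then have "(\<Sum>w\<in>T. max 0 (t - \<bar>1 - c w\<bar>)) = 0"
        by (intro sum.neutral) fastforce
      with dom[of 1] less.prems(2) assms(2) show False by simp
    qed
    then obtain w1 where w1: "w1 \<in> T" "c w1 \<le> t" by blast
    \<comment> \<open>Since \<open>c w1 > t - r + 1\<close>, the tower \<open>w1\<close> gives
      column 1 at most \<open>r - 1\<close>, and towers beyond column \<open>t\<close> give it
      nothing.\<close>
    have "\<exists>w2\<in>T - {w1}. c w2 \<le> t"
    proof (rule ccontr)
      assume "\<not> ?thesis"
      then have "c w > t" if "w \<in> T - {w1}" for w using that by force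
      then have "(\<Sum>w\<in>T - {w1}. max 0 (t - \<bar>1 - c w\<bar>)) = 0"
        by (intro sum.neutral) fastforce
      then have "(\<Sum>w\<in>T. max 0 (t - \<bar>1 - c w\<bar>)) = max 0 (t - \<bar>1 - c w1\<bar>)"
        using sum.remove[OF fin w1(1), of "\<lambda>w. max 0 (t - \<bar>1 - c w\<bar>)"] by simp
      with dom[of 1] less.prems(2) 2[OF w1(1)] assms(2,3) show False by simp
    qed
    then obtain w2 where w2: "w2 \<in> T" "c w2 \<le> t" "w1 \<noteq> w2" by blast
    have sub: "{w1, w2} \<subseteq> T" using w1 w2 by simp
    have two: "2 \<le> card T" using card_mono[OF fin sub] w2(3) by simp
    show ?thesis
    proof (cases "2 * t - 1 < n")
      case True
      \<comment> \<open>Two towers may account for \<open>2 * (2 * t - r)\<close> columns, which is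
        more than \<open>2 * t - 1\<close> because \<open>r < t\<close>.\<close>
      show ?thesis
        by (rule cut[of "{w1, w2}" "2 * t - 1"]) (use True sub w1 w2 assms(2,3) in auto)
    next
      case False
      show ?thesis
      proof (cases "3 \<le> card T")
        case True
        then show ?thesis using False mult[of 3] assms(2,3) by simp
      next
        case False
        then have card: "card T = 2" using two by simp
        then have T: "T = {w1, w2}"
          using card_subset_eq[OF fin sub] w2(3) by simp
        have "r \<le> max 0 (t - \<bar>1 - c w1\<bar>) + max 0 (t - \<bar>1 - c w2\<bar>)"
          "r \<le> max 0 (t - \<bar>n - c w1\<bar>) + max 0 (t - \<bar>n - c w2\<bar>)"
          using dom[of 1] dom[of n] less.prems(2) w2(3) by (simp_all add: T)
        \<comment> \<open>Column 1 forces \<open>c w1 + c w2 \<le> 2 * t + 2 - r\<close>. If only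
          one tower reaches column \<open>n\<close>, then \<open>n \<le> 2 * t - r\<close>, as its
          column is at most \<open>t\<close>; if both do, adding the two bounds gives
          \<open>n \<le> 2 * t - r + 1\<close>. Either is enough since \<open>r < t\<close>.\<close>
        then have "n + r - 1 \<le> 2 * (2 * t - r)"
          using w1 w2 2[of w1] 2[of w2] assms(2,3) by (simp add: max_def abs_if split: if_splits)
        then show ?thesis by (simp add: card)
      qed
    qed
  qed
qed

lemma king_grid_lower_bound:
  assumes "m \<ge> 1" "n \<ge> 1" "r \<ge> 1" "t > r" "broadcast_dominating (king_grid m n) t r T"
  shows "int n + int r - 1 \<le> int (card T) * (2 * int t - int r)"
proof (rule path_broadcast_lower_bound[where c = snd])
  have T: "T \<subseteq> verts (king_grid m n)"
    using assms(5) by (simp add: broadcast_dominating_def)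
  then show "finite T" by (rule finite_subset) (simp add: verts_king_grid)
  fix x :: int assume x: "1 \<le> x" "x \<le> int n"
  then have v: "(1, x) \<in> verts (king_grid m n)" using assms(1) by (simp add: verts_king_grid)
  then have "int r \<le> broadcast_signal (king_grid m n) t T (1, x)"
    using assms(5) by (simp add: broadcast_dominating_def)
  also have "\<dots> \<le> (\<Sum>w\<in>T. max 0 (int t - \<bar>x - snd w\<bar>))"
    unfolding broadcast_signal_def
    by (rule sum_mono) (use T graph_dist_king_grid[OF v] in force)
  finally show "int r \<le> (\<Sum>w\<in>T. max 0 (int t - \<bar>x - snd w\<bar>))" .
qed (use assms in auto)

section \<open>Construction of a dominating set\<close>

text \<open>Only \<open>card T \<le> k\<close> is claimed because clamping columns to
  \<open>n\<close> can make towers coincide.\<close>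

lemma king_grid_dominating_exists:
  assumes "m \<ge> 1" "n \<ge> 1" "r \<ge> 1" "t > r" "m \<le> 2 * (t - r) + 1"
    and "k \<ge> 1" and k: "int n + int r - 1 \<le> int k * (2 * int t - int r)"
  shows "\<exists>T. broadcast_dominating (king_grid m n) t r T \<and> card T \<le> k"
proof -
  define q where "q = int t - int r"
  define s where "s = 2 * int t - int r"
  define row where "row = min (int m) (q + 1)"
  define col where "col i = min (int n) (q + 1 + int i * s)" for i
  define T where "T = (\<lambda>i. (row, col i)) ` {..<k}"
  have "s > 0" "q > 0" using assms by (auto simp: s_def q_def)
  have T: "T \<subseteq> verts (king_grid m n)"
    using assms(1,2) \<open>s > 0\<close> \<open>q > 0\<close>
    by (auto simp: T_def verts_king_grid row_def col_def)
  have "finite T" by (simp add: T_def)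
  have "int r \<le> broadcast_signal (king_grid m n) t T v" if v: "v \<in> verts (king_grid m n)" for v
  proof -
    obtain y x where yx: "v = (y, x)" by (cases v)
    have y: "1 \<le> y" "y \<le> int m" and x: "1 \<le> x" "x \<le> int n"
      using v by (auto simp: yx verts_king_grid)
    have row: "\<bar>y - row\<bar> \<le> q"
      using y assms(4,5) by (auto simp: row_def q_def)
    let ?f = "\<lambda>w. max 0 (int t - int (graph_dist (king_grid m n) v w))"
    \<comment> \<open>The row offset is at most \<open>q\<close>, so it matters only within
      \<open>q\<close> columns of the tower, where the signal is still at least
      \<open>t - q = r\<close>.\<close>
    have f: "?f (row, col i) \<ge> int t - max q \<bar>x - col i\<bar>" if "i < k" for i
    proof -
      have "(row, col i) \<in> verts (king_grid m n)" using T that by (auto simp: T_def)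
      from graph_dist_king_grid[OF v this] row show ?thesis
        by (simp add: yx le_max_iff_disj) linarith
    qed
    have sub: "sum ?f A \<le> broadcast_signal (king_grid m n) t T v" if "A \<subseteq> T" for A
      unfolding broadcast_signal_def by (rule sum_mono2[OF \<open>finite T\<close> that]) simp
    show ?thesis
    proof (cases "\<exists>i<k. \<bar>x - col i\<bar> \<le> q")
      case True
      then obtain i where i: "i < k" "\<bar>x - col i\<bar> \<le> q" by blast
      have "int r \<le> sum ?f {(row, col i)}" using f[OF i(1)] i(2) by (simp add: q_def)
      also have "\<dots> \<le> broadcast_signal (king_grid m n) t T v"
        by (rule sub) (use i(1) in \<open>auto simp: T_def\<close>)
      finally show ?thesis .
    next
      case False
      then have far: "\<bar>x - col i\<bar> > q" if "i < k" for i using that by force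
      \<comment> \<open>As \<open>col 0 \<le> q + 1\<close>, the first tower is within
        \<open>q\<close> of every column to its left.\<close>
      have "col 0 < x" using far[of 0] assms(6) x by (auto simp: col_def)
      \<comment> \<open>The bound on \<open>k\<close> enters here:
        \<open>q + 1 + (k - 1) * s \<ge> n + r - t = n - q\<close>, so the last tower is within
        \<open>q\<close> of every column to its right.\<close>
      have "col (k - 1) \<ge> int n - q"
        using k assms(4,6) by (auto simp: col_def s_def q_def of_nat_diff algebra_simps)
      then have "\<not> col (k - 1) < x" using far[of "k - 1"] assms(6) x by force
      \<comment> \<open>The least such \<open>i\<close> puts \<open>x\<close> between two
        consecutive towers at most \<open>s\<close> apart. Both are farther than \<open>q\<close>
        away, so their signals add up to at least \<open>2 * t - s = r\<close>.\<close>
      define i where "i = (LEAST i. \<not> col i < x)"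
      have i: "\<not> col i < x" "i \<le> k - 1"
        using \<open>\<not> col (k - 1) < x\<close> unfolding i_def by (rule LeastI, rule Least_le)
      have "i \<noteq> 0" using i(1) \<open>col 0 < x\<close> by metis
      then obtain j where j: "i = Suc j" by (cases i) auto
      have "col j < x" using not_less_Least[of j "\<lambda>i. \<not> col i < x"] j by (simp add: i_def)
      have ltk: "j < k" "Suc j < k" using i(2) j assms(6) by auto
      have gap: "col (Suc j) - col j \<le> s" using \<open>s > 0\<close> by (auto simp: col_def algebra_simps)
      have "int r \<le> ?f (row, col j) + ?f (row, col (Suc j))"
        using f[OF ltk(1)] f[OF ltk(2)] far[OF ltk(1)] far[OF ltk(2)] gap i(1) \<open>col j < x\<close>
        by (simp add: j s_def)
      also have "\<dots> = sum ?f {(row, col j), (row, col (Suc j))}"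
        using i(1) \<open>col j < x\<close> by (simp add: j)
      also have "\<dots> \<le> broadcast_signal (king_grid m n) t T v"
        by (rule sub) (use ltk in \<open>auto simp: T_def\<close>)
      finally show ?thesis .
    qed
  qed
  then have "broadcast_dominating (king_grid m n) t r T"
    using T by (simp add: broadcast_dominating_def)
  moreover have "card T \<le> k" unfolding T_def using card_image_le[of "{..<k}"] by fastforce
  ultimately show ?thesis by blast
qed

theorem theorem1p5:
  fixes m n t r :: nat
  assumes "m \<ge> 1" and "n \<ge> 1"
    and "r \<ge> 1" and "t > r"
    and "m \<le> 2 * (t - r) + 1"
  shows "int (broadcast_domination_number (king_grid m n) t r) =
           \<lceil>(real n + real r - 1) / (2 * real t - real r)\<rceil>"
proof -
  let ?G = "king_grid m n"
  let ?g = "broadcast_domination_number ?G t r"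
  let ?z = "(real n + real r - 1) / (2 * real t - real r)"
  have pos: "2 * real t - real r > 0" using assms(4) by simp
  have "?z > 0" using pos assms(2,3) by (intro divide_pos_pos) auto
  define k where "k = nat \<lceil>?z\<rceil>"
  have k: "int k = \<lceil>?z\<rceil>" "k \<ge> 1"
    using \<open>?z > 0\<close> by (simp_all add: k_def le_nat_iff)
  have "?z \<le> real k" using k(1) by (metis le_of_int_ceiling of_int_of_nat_eq)
  then have "real n + real r - 1 \<le> real k * (2 * real t - real r)"
    using pos by (simp add: pos_divide_le_eq)
  then have "real_of_int (int n + int r - 1) \<le> real_of_int (int k * (2 * int t - int r))" by simp
  then have "int n + int r - 1 \<le> int k * (2 * int t - int r)" by (simp only: of_int_le_iff)
  then obtain T where T: "broadcast_dominating ?G t r T" "card T \<le> k"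
    using king_grid_dominating_exists[OF assms k(2)] by blast
  have "?g \<le> card T"
    unfolding broadcast_domination_number_def by (rule Least_le) (use T in blast)
  with T have upper: "?g \<le> k" by simp
  \<comment> \<open>The constructed \<open>T\<close> shows that the \<open>LEAST\<close> has a
    candidate, so the minimum is attained and the lower bound applies to it.\<close>
  have "\<exists>T. broadcast_dominating ?G t r T \<and> card T = ?g"
    unfolding broadcast_domination_number_def by (rule LeastI_ex) (use T in blast)
  then have "int n + int r - 1 \<le> int ?g * (2 * int t - int r)"
    using king_grid_lower_bound[OF assms(1-4)] by metis
  then have "real_of_int (int n + int r - 1) \<le> real_of_int (int ?g * (2 * int t - int r))"
    by (simp only: of_int_le_iff)
  then have "?z \<le> real ?g" using pos by (simp add: pos_divide_le_eq)
  then have "\<lceil>?z\<rceil> \<le> int ?g" by (simp add: ceiling_le_iff)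
  with upper k(1) show ?thesis by simp
qed

end
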